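(* For $i=1,2$, let $(X_i,\tau_i)$ be a zero-dimensional Hausdorff space, let $(Y_i,f_i)$ be a zero-dimensional Hausdorff local compactification of $(X_i,\tau_i)$, and let $A_i=\{f_i^{-1}(U) : U\in CO(Y_i)\}$ and $I_i=\{f_i^{-1}(U) : U\in CK(Y_i)\}$. Let $f:X_1\to X_2$ be a function such that $f^{-1}(G)\in A_1$ for every $G\in A_2$, and such that for every $F\in I_1$ there is $G\in I_2$ with $f(F)\subseteq G$. Let $g:Y_1\to Y_2$ be the continuous function such that $g\circ f_1=f_2\circ f$ (it exists under these conditions on $f$). Then: (a) $g$ is skeletal iff $f$ is skeletal; (b) $g$ is an open map iff $f$ satisfies (ZO): for every $F\in I_1$, $\mathrm{cl}_{X_2}(f(F))\in I_2$; (c) $g$ is a perfect map iff $f$ satisfies (ZP): for every $G\in I_2$, $f^{-1}(G)\in I_1$; (d) $\mathrm{cl}_{Y_2}(g(Y_1))=Y_2$ iff $\mathrm{cl}_{X_2}(f(X_1))=X_2$; (e) $g$ is an injection iff $f$ satisfies (ZI): for every $F_1,F_2\in I_1$ with $F_1\cap F_2=\emptyset$ there exist $G_1,G_2\in I_2$ with $G_1\cap G_2=\emptyset$ and $f(F_i)\subseteq G_i$ for $i=1,2$; (f) $g$ is an open injection iff $I_1\subseteq f^{-1}(I_2)$ and $f$ satisfies (ZO); (g) $g$ is a closed injection iff $f^{-1}(I_2)=I_1$; (h) $g$ is a perfect surjection iff $f$ satisfies (ZP) and $\mathrm{cl}_{X_2}(f(X_1))=X_2$; (i) $g$ is a dense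 embedding iff $\mathrm{cl}_{X_2}(f(X_1))=X_2$ and $I_1\subseteq f^{-1}(I_2)$. Here $f^{-1}(I_2)=\{f^{-1}(G) : G\in I_2\}$.
   Context: A space is zero-dimensional if it has a base of clopen sets. A zero-dimensional Hausdorff local compactification of $X$ is a pair $(Y,f)$ where $Y$ is a zero-dimensional locally compact Hausdorff space and $f:X\to Y$ is a homeomorphic embedding with dense image. $CO(Y)$ is the set of all clopen subsets of $Y$ and $CK(Y)$ the set of all compact clopen subsets of $Y$. Closed maps and open maps are assumed continuous but not necessarily onto. A map is perfect if it is closed and all its point inverses are compact (not necessarily onto). A function $h:X\to Y$ between topological spaces is skeletal if $\mathrm{int}(h^{-1}(\mathrm{cl}(V)))\subseteq\mathrm{cl}(h^{-1}(V))$ for every open $V\subseteq Y$. A dense embedding is a homeomorphic embedding with dense image. *)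

theory Defs
  imports "HOL-Analysis.Analysis"
begin

definition zero_dimensional :: "'a topology \<Rightarrow> bool" where
  "zero_dimensional X \<longleftrightarrow>
     (\<exists>\<B>. (\<forall>B\<in>\<B>. openin X B \<and> closedin X B) \<and>
          openin X = arbitrary union_of (\<lambda>B. B \<in> \<B>))"

definition CO :: "'a topology \<Rightarrow> 'a set set" where
  "CO X = {U. openin X U \<and> closedin X U}"

definition CK :: "'a topology \<Rightarrow> 'a set set" where
  "CK X = {U. U \<in> CO X \<and> compactin X U}"

definition preimage_on :: "'a topology \<Rightarrow> ('a \<Rightarrow> 'b) \<Rightarrow> 'b set \<Rightarrow> 'a set" where
  "preimage_on X f U = {x \<in> topspace X. f x \<in> U}"

definition dense_embedding :: "'a topology \<Rightarrow> 'b topology \<Rightarrow> ('a \<Rightarrow> 'b) \<Rightarrow> bool" where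
  "dense_embedding X Y f \<longleftrightarrow>
     embedding_map X Y f \<and> Y closure_of (f ` topspace X) = topspace Y"

definition zd_local_compactification ::
    "'a topology \<Rightarrow> 'b topology \<Rightarrow> ('a \<Rightarrow> 'b) \<Rightarrow> bool" where
  "zd_local_compactification X Y f \<longleftrightarrow>
     zero_dimensional Y \<and> locally_compact_space Y \<and> Hausdorff_space Y \<and>
     dense_embedding X Y f"

definition skeletal_map :: "'a topology \<Rightarrow> 'b topology \<Rightarrow> ('a \<Rightarrow> 'b) \<Rightarrow> bool" where
  "skeletal_map X Y h \<longleftrightarrow>
     (\<forall>V. openin Y V \<longrightarrow>
        X interior_of (preimage_on X h (Y closure_of V)) \<subseteq> X closure_of (preimage_on X h V))"

(* The library's open_map, closed_map and proper_map do not include continuity, while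
   open, closed and perfect maps are continuous here. The library's perfect_map, on the
   other hand, is required to be onto, which is not intended here. *)

definition cont_open_map :: "'a topology \<Rightarrow> 'b topology \<Rightarrow> ('a \<Rightarrow> 'b) \<Rightarrow> bool" where
  "cont_open_map X Y h \<longleftrightarrow> continuous_map X Y h \<and> open_map X Y h"

definition cont_closed_map :: "'a topology \<Rightarrow> 'b topology \<Rightarrow> ('a \<Rightarrow> 'b) \<Rightarrow> bool" where
  "cont_closed_map X Y h \<longleftrightarrow> continuous_map X Y h \<and> closed_map X Y h"

definition perfect_into_map :: "'a topology \<Rightarrow> 'b topology \<Rightarrow> ('a \<Rightarrow> 'b) \<Rightarrow> bool" where
  "perfect_into_map X Y h \<longleftrightarrow>
     cont_closed_map X Y h \<and> (\<forall>y \<in> topspace Y. compactin X (preimage_on X h {y}))"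

end

theory Submission
  imports Defs
begin

text \<open>
  The compact clopen sets of a zero-dimensional locally compact Hausdorff space form a base, so
  openness, properness, injectivity and being an embedding can be read off the action of \<open>g\<close> on
  them. A clopen set is determined by its trace on a dense subset, so these conditions translate
  into conditions on the traces, that is on \<open>I1\<close> and \<open>I2\<close>. To construct \<open>g\<close>, note that taking
  preimages under \<open>f\<close> induces a Boolean homomorphism \<open>H\<close> from \<open>CO Y2\<close> to \<open>CO Y1\<close>; the clopen sets
  \<open>M\<close> with \<open>y \<in> H M\<close> form an ultrafilter that contains a compact set, and \<open>g y\<close> is its limit.
  For (a), \<open>h\<close> is skeletal iff the closure of the image of each nonempty open set has nonempty
  interior, and both closure and interior are compatible with traces.
\<close>

section \<open>Preimages and clopen sets\<close>

lemma preimage_on_Int: "preimage_on X f (U \<inter> V) = preimage_on X f U \<inter> preimage_on X f V"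
  and preimage_on_Un: "preimage_on X f (U \<union> V) = preimage_on X f U \<union> preimage_on X f V"
  and preimage_on_Diff: "preimage_on X f (U - V) = preimage_on X f U - preimage_on X f V"
  and preimage_on_empty: "preimage_on X f {} = {}"
  and preimage_on_subset: "preimage_on X f U \<subseteq> topspace X"
  and preimage_on_mono: "U \<subseteq> V \<Longrightarrow> preimage_on X f U \<subseteq> preimage_on X f V"
  by (auto simp: preimage_on_def)

lemma openin_preimage_on:
  "continuous_map X Y f \<Longrightarrow> openin Y U \<Longrightarrow> openin X (preimage_on X f U)"
  unfolding preimage_on_def by (rule openin_continuous_map_preimage)

lemma closedin_preimage_on:
  "continuous_map X Y f \<Longrightarrow> closedin Y C \<Longrightarrow> closedin X (preimage_on X f C)"
  unfolding preimage_on_def by (rule closedin_continuous_map_preimage)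

lemma CO_preimage_on: "continuous_map X Y f \<Longrightarrow> U \<in> CO Y \<Longrightarrow> preimage_on X f U \<in> CO X"
  by (simp add: CO_def openin_preimage_on closedin_preimage_on)

lemma CO_Un: "U \<in> CO X \<Longrightarrow> V \<in> CO X \<Longrightarrow> U \<union> V \<in> CO X"
  and CO_Diff: "U \<in> CO X \<Longrightarrow> V \<in> CO X \<Longrightarrow> U - V \<in> CO X"
  and CO_topspace: "topspace X \<in> CO X"
  and CO_empty: "{} \<in> CO X"
  by (auto simp: CO_def openin_diff closedin_diff)

lemma CK_Union:
  assumes "finite \<F>" "\<F> \<subseteq> CK X"
  shows "\<Union>\<F> \<in> CK X"
proof -
  have "closedin X (\<Union>\<F>)" "openin X (\<Union>\<F>)" "compactin X (\<Union>\<F>)"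
    using assms by (intro closedin_Union openin_Union compactin_Union; auto simp: CK_def CO_def)+
  then show ?thesis by (simp add: CK_def CO_def)
qed

lemma zero_dimensional_CO_base:
  assumes "zero_dimensional X" "openin X U" "x \<in> U"
  obtains B where "B \<in> CO X" "x \<in> B" "B \<subseteq> U"
proof -
  obtain \<B> where \<B>: "\<forall>B\<in>\<B>. openin X B \<and> closedin X B"
      "openin X = arbitrary union_of (\<lambda>B. B \<in> \<B>)"
    using assms(1) by (auto simp: zero_dimensional_def)
  with assms(2) obtain \<U> where "\<U> \<subseteq> \<B>" "\<Union>\<U> = U"
    by (auto simp: union_of_def arbitrary_def)
  with assms(3) \<B>(1) that show ?thesis
    by (auto simp: CO_def)
qed

section \<open>Skeletal maps\<close>

text \<open>If the closure of \<open>h\<close> U\<open>had empty interior, its complement would be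
  open and dense; skeletality makes the preimage of that complement dense, so it
  meets\<close>U\<open>, which is absurd. Conversely, if the inclusion fails for\<close>V\<open>, the difference of its two sides contains a nonempty open\<close>U\<open>whose image lies in the closure of\<close>V\<open>but misses\<close>V\<open>, so the closure of\<close>h
  \<open>U\<close> lies in the nowhere dense frontier of \<open>V\<close>.\<close>

lemma skeletal_map_iff:
  assumes h: "h \<in> topspace X \<rightarrow> topspace Y"
  shows "skeletal_map X Y h \<longleftrightarrow>
    (\<forall>U. openin X U \<and> U \<noteq> {} \<longrightarrow> Y interior_of (Y closure_of (h ` U)) \<noteq> {})"
proof (intro iffI allI impI notI)
  fix U assume sk: "skeletal_map X Y h" and U: "openin X U \<and> U \<noteq> {}"
    and e: "Y interior_of (Y closure_of (h ` U)) = {}"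
  let ?V = "topspace Y - Y closure_of (h ` U)"
  have V: "openin Y ?V" by (simp add: openin_diff)
  have "Y closure_of ?V = topspace Y"
    using e by (simp add: interior_of_eq_empty_complement)
  then have "preimage_on X h (Y closure_of ?V) = topspace X"
    using h by (auto simp: preimage_on_def)
  with sk V have "topspace X \<subseteq> X closure_of (preimage_on X h ?V)"
    unfolding skeletal_map_def by (metis interior_of_topspace)
  then have "X closure_of (preimage_on X h ?V) = topspace X"
    using closure_of_subset_topspace by fastforce
  then have "preimage_on X h ?V \<inter> U \<noteq> {}"
    using U dense_intersects_open by metis
  moreover have "h ` U \<subseteq> Y closure_of (h ` U)"
    using U h openin_subset by (intro closure_of_subset) fastforce
  ultimately show False by (auto simp: preimage_on_def)
next
  assume R: "\<forall>U. openin X U \<and> U \<noteq> {} \<longrightarrow> Y interior_of (Y closure_of (h ` U)) \<noteq> {}"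
  show "skeletal_map X Y h"
    unfolding skeletal_map_def
  proof (intro allI impI)
    fix V assume V: "openin Y V"
    let ?P = "preimage_on X h V"
    define U where "U = X interior_of (preimage_on X h (Y closure_of V)) - X closure_of ?P"
    have "U = {}"
    proof (rule ccontr)
      assume "U \<noteq> {}"
      moreover have "openin X U" by (auto simp: U_def)
      ultimately have W: "Y interior_of (Y closure_of (h ` U)) \<noteq> {}" using R by blast
      have "h ` U \<subseteq> Y closure_of V"
        using interior_of_subset by (fastforce simp: U_def preimage_on_def)
      then have "Y closure_of (h ` U) \<subseteq> Y closure_of V"
        by (simp add: closure_of_minimal)
      moreover have "h ` U \<inter> V = {}"
        using closure_of_subset[OF preimage_on_subset, of X h V]
          openin_subset[OF \<open>openin X U\<close>]
        by (auto simp: U_def preimage_on_def)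
      then have "V \<inter> Y closure_of (h ` U) = {}"
        using V by (simp add: openin_Int_closure_of_eq_empty Int_commute)
      then have "Y interior_of (Y closure_of (h ` U)) \<inter> V = {}"
        using interior_of_subset by fastforce
      then have "Y interior_of (Y closure_of (h ` U)) \<inter> Y closure_of V = {}"
        by (simp add: openin_Int_closure_of_eq_empty)
      ultimately show False
        using W interior_of_subset[of Y "Y closure_of (h ` U)"] by blast
    qed
    then show "X interior_of (preimage_on X h (Y closure_of V)) \<subseteq> X closure_of ?P"
      by (auto simp: U_def)
  qed
qed

section \<open>Traces on dense subsets and along embeddings\<close>

lemma closure_of_preimage_dense:
  assumes h: "continuous_map X Y h" and d: "Y closure_of (h ` topspace X) = topspace Y"
    and U: "openin Y U"
  shows "Y closure_of (h ` preimage_on X h U) = Y closure_of U"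
proof -
  have "h ` preimage_on X h U = U \<inter> h ` topspace X"
    by (auto simp: preimage_on_def)
  then show ?thesis
    using closure_of_openin_Int_closure_of[OF U, of "h ` topspace X"]
    by (metis U d inf.absorb1 openin_subset)
qed

text \<open>\<open>U - C\<close> is open and misses the dense image, hence empty. This is the tool
  for lifting inclusions of traces back to the larger space.\<close>

lemma preimage_on_dense_subset:
  assumes d: "Y closure_of (h ` topspace X) = topspace Y"
    and U: "openin Y U" and C: "closedin Y C"
    and sub: "preimage_on X h U \<subseteq> preimage_on X h C"
  shows "U \<subseteq> C"
proof -
  have "openin Y (U - C)" using U C by blast
  moreover have "h ` topspace X \<inter> (U - C) = {}"
    using sub by (auto simp: preimage_on_def)
  ultimately show ?thesis
    using d dense_intersects_open by (metis Diff_eq_empty_iff)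
qed

lemma preimage_on_dense_eq_empty_iff:
  assumes "Y closure_of (h ` topspace X) = topspace Y" "openin Y U"
  shows "preimage_on X h U = {} \<longleftrightarrow> U = {}"
  using preimage_on_dense_subset[OF assms, of "{}"] by (auto simp: preimage_on_empty)

text \<open>Clopen sets are open and closed at once, so an equality of traces lifts in both
  directions.\<close>

lemma inj_on_preimage_on_dense:
  assumes "Y closure_of (h ` topspace X) = topspace Y"
  shows "inj_on (preimage_on X h) (CO Y)"
proof (rule inj_onI)
  fix U V assume "U \<in> CO Y" "V \<in> CO Y" "preimage_on X h U = preimage_on X h V"
  then show "U = V"
    using preimage_on_dense_subset[OF assms, of U V] preimage_on_dense_subset[OF assms, of V U]
    by (simp add: CO_def subset_antisym)
qed

lemma embedding_map_imp_continuous_map: "embedding_map X Y h \<Longrightarrow> continuous_map X Y h"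
  unfolding embedding_map_def
  by (metis continuous_map_in_subtopology homeomorphic_imp_continuous_map)

lemma embedding_map_openin:
  assumes "embedding_map X Y h" "openin X U"
  obtains V where "openin Y V" "U = preimage_on X h V"
proof -
  have "openin (subtopology Y (h ` topspace X)) (h ` U)"
    using assms homeomorphic_map_openness_eq unfolding embedding_map_def by fastforce
  then obtain V where V: "openin Y V" "h ` U = V \<inter> h ` topspace X"
    by (auto simp: openin_subtopology)
  moreover have "inj_on h (topspace X)"
    using assms(1) by (simp add: embedding_map_def homeomorphic_map_def)
  ultimately have "U = preimage_on X h V"
    using openin_subset[OF assms(2)] unfolding preimage_on_def inj_on_def by blast
  with V that show ?thesis by blast
qed

text \<open>\<open>h\<close> is a homeomorphism onto its image, and closure in a subspace is the
  trace of the closure.\<close>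

lemma embedding_map_closure_of:
  assumes h: "embedding_map X Y h" and S: "S \<subseteq> topspace X"
  shows "X closure_of S = preimage_on X h (Y closure_of (h ` S))"
proof -
  let ?D = "h ` topspace X"
  have inj: "inj_on h (topspace X)"
    using h by (simp add: embedding_map_def homeomorphic_map_def)
  have "h ` (X closure_of S) = subtopology Y ?D closure_of (h ` S)"
    using h S homeomorphic_map_closure_of unfolding embedding_map_def by fastforce
  also have "\<dots> = ?D \<inter> Y closure_of (h ` S)"
    using S by (simp add: closure_of_subtopology image_mono inf.absorb2)
  finally have "h ` (X closure_of S) = ?D \<inter> Y closure_of (h ` S)" .
  with inj closure_of_subset_topspace[of X S] show ?thesis
    unfolding preimage_on_def inj_on_def by blast
qed

lemma continuous_map_CO_base:
  assumes Y: "zero_dimensional Y" and g: "g \<in> topspace X \<rightarrow> topspace Y"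
    and pre: "\<And>M. M \<in> CO Y \<Longrightarrow> preimage_on X g M \<in> CO X"
  shows "continuous_map X Y g"
  unfolding continuous_map_def
proof (intro conjI allI impI g)
  fix U assume U: "openin Y U"
  show "openin X {x \<in> topspace X. g x \<in> U}"
  proof (subst openin_subopen, intro ballI)
    fix x assume x: "x \<in> {x \<in> topspace X. g x \<in> U}"
    then obtain B where "B \<in> CO Y" "g x \<in> B" "B \<subseteq> U"
      using zero_dimensional_CO_base[OF Y U] by blast
    with x pre[of B]
    show "\<exists>T. openin X T \<and> x \<in> T \<and> T \<subseteq> {x \<in> topspace X. g x \<in> U}"
      by (intro exI[of _ "preimage_on X g B"]) (auto simp: preimage_on_def CO_def)
  qed
qed

section \<open>Compact clopen sets in zero-dimensional locally compact Hausdorff spaces\<close>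

locale zd_lc_Hausdorff =
  fixes Y :: "'a topology"
  assumes zd: "zero_dimensional Y" and lc: "locally_compact_space Y"
    and Hausdorff: "Hausdorff_space Y"
begin

text \<open>A clopen set contained in a compact neighbourhood is compact, being closed in
  it.\<close>

lemma CK_base:
  assumes "openin Y U" "y \<in> U"
  obtains K where "K \<in> CK Y" "y \<in> K" "K \<subseteq> U"
proof -
  have "y \<in> topspace Y" using assms openin_subset by blast
  then obtain V C where V: "openin Y V" "compactin Y C" "y \<in> V" "V \<subseteq> C"
    using lc by (auto simp: locally_compact_space_def)
  with assms obtain B where "B \<in> CO Y" "y \<in> B" "B \<subseteq> U \<inter> V"
    using zero_dimensional_CO_base[OF zd openin_Int[OF assms(1) V(1)]] by blast
  moreover from this V have "compactin Y B"
    by (intro closed_compactin[OF V(2)]) (auto simp: CO_def)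
  ultimately show ?thesis using that by (auto simp: CK_def)
qed

text \<open>Finitely many members of the base inside \<open>U\<close> cover \<open>C\<close>, and
  their union is again compact and clopen.\<close>

lemma CK_between:
  assumes C: "compactin Y C" and U: "openin Y U" and "C \<subseteq> U"
  obtains K where "K \<in> CK Y" "C \<subseteq> K" "K \<subseteq> U"
proof -
  let ?\<U> = "{K \<in> CK Y. K \<subseteq> U}"
  have "C \<subseteq> \<Union>?\<U>"
    using CK_base[OF U] \<open>C \<subseteq> U\<close> by blast
  moreover have "\<And>K. K \<in> ?\<U> \<Longrightarrow> openin Y K" by (auto simp: CK_def CO_def)
  ultimately obtain \<F> where \<F>: "finite \<F>" "\<F> \<subseteq> ?\<U>" "C \<subseteq> \<Union>\<F>"
    using compactinD[OF C, of ?\<U>] by blast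
  show ?thesis
    by (rule that[of "\<Union>\<F>"]) (use \<F> in \<open>auto intro!: CK_Union\<close>)
qed

lemma compactin_separated_CK:
  assumes "compactin Y C" "closedin Y D" "C \<inter> D = {}"
  obtains K where "K \<in> CK Y" "C \<subseteq> K" "K \<inter> D = {}"
proof -
  have "C \<subseteq> topspace Y - D"
    using assms compactin_subset_topspace by fastforce
  then obtain K where "K \<in> CK Y" "C \<subseteq> K" "K \<subseteq> topspace Y - D"
    using CK_between[OF assms(1) openin_diff[OF openin_topspace assms(2)]] by metis
  then show ?thesis by (intro that[of K]) auto
qed

lemma compactin_closedin: "compactin Y C \<Longrightarrow> closedin Y C"
  using Hausdorff compactin_imp_closedin by blast

lemma CK_separate_points:
  assumes "y \<in> topspace Y" "z \<in> topspace Y" "y \<noteq> z"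
  obtains K where "K \<in> CK Y" "y \<in> K" "z \<notin> K"
proof -
  have "compactin Y {y}" "closedin Y {z}" "{y} \<inter> {z} = {}"
    using assms by (auto intro: compactin_closedin)
  then obtain K where "K \<in> CK Y" "{y} \<subseteq> K" "K \<inter> {z} = {}"
    by (rule compactin_separated_CK)
  then show ?thesis by (intro that[of K]) auto
qed

lemma compactin_CK: "compactin Y K \<Longrightarrow> openin Y K \<Longrightarrow> K \<in> CK Y"
  by (simp add: CK_def CO_def compactin_closedin)

end

section \<open>Continuous maps described by their action on compact clopen sets\<close>

locale zd_lc_Hausdorff_map = Y1: zd_lc_Hausdorff Y1 + Y2: zd_lc_Hausdorff Y2
  for Y1 :: "'a topology" and Y2 :: "'b topology" +
  fixes g :: "'a \<Rightarrow> 'b"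
  assumes cont: "continuous_map Y1 Y2 g"
begin

lemma image_CK: "K \<in> CK Y1 \<Longrightarrow> compactin Y2 (g ` K)"
  using cont by (auto simp: CK_def intro: image_compactin)

text \<open>The image of a compact clopen set is always compact, hence closed, so only its openness
  is at stake; the base extends this to all open sets.\<close>

lemma open_map_iff_CK: "open_map Y1 Y2 g \<longleftrightarrow> (\<forall>K\<in>CK Y1. g ` K \<in> CK Y2)"
proof
  assume "open_map Y1 Y2 g"
  then show "\<forall>K\<in>CK Y1. g ` K \<in> CK Y2"
    using Y2.compactin_CK image_CK by (auto simp: open_map_def CK_def CO_def)
next
  assume R: "\<forall>K\<in>CK Y1. g ` K \<in> CK Y2"
  show "open_map Y1 Y2 g"
    unfolding open_map_def
  proof (intro allI impI)
    fix U assume U: "openin Y1 U"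
    have "\<exists>T. openin Y2 T \<and> g x \<in> T \<and> T \<subseteq> g ` U" if x: "x \<in> U" for x
    proof -
      obtain K where "K \<in> CK Y1" "x \<in> K" "K \<subseteq> U" by (rule Y1.CK_base[OF U x])
      with R show ?thesis by (intro exI[of _ "g ` K"]) (auto simp: CK_def CO_def)
    qed
    then show "openin Y2 (g ` U)" by (subst openin_subopen) blast
  qed
qed

lemma perfect_into_map_iff_proper_map: "perfect_into_map Y1 Y2 g \<longleftrightarrow> proper_map Y1 Y2 g"
  using cont by (simp add: perfect_into_map_def cont_closed_map_def proper_map_def preimage_on_def)

text \<open>A compact \<open>C\<close> lies in some compact clopen \<open>L\<close>, and its
  preimage is closed in the compact preimage of \<open>L\<close>. Since \<open>Y2\<close> is a
  Hausdorff k-space, compactness of all such preimages makes \<open>g\<close> proper.\<close>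

lemma proper_map_iff_CK: "proper_map Y1 Y2 g \<longleftrightarrow> (\<forall>L\<in>CK Y2. preimage_on Y1 g L \<in> CK Y1)"
proof
  assume "proper_map Y1 Y2 g"
  then show "\<forall>L\<in>CK Y2. preimage_on Y1 g L \<in> CK Y1"
    using CO_preimage_on[OF cont] compactin_proper_map_preimage
    by (fastforce simp: CK_def preimage_on_def)
next
  assume R: "\<forall>L\<in>CK Y2. preimage_on Y1 g L \<in> CK Y1"
  show "proper_map Y1 Y2 g"
  proof (rule compact_imp_proper_map)
    fix C assume C: "compactin Y2 C"
    then obtain L where L: "L \<in> CK Y2" "C \<subseteq> L"
      using Y2.CK_between[OF C openin_topspace compactin_subset_topspace[OF C]] by metis
    have "compactin Y1 (preimage_on Y1 g C)"
    proof (rule closed_compactin)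
      show "compactin Y1 (preimage_on Y1 g L)" using R L by (auto simp: CK_def)
      show "closedin Y1 (preimage_on Y1 g C)"
        using C by (intro closedin_preimage_on[OF cont] Y2.compactin_closedin)
    qed (use L in \<open>simp add: preimage_on_mono\<close>)
    then show "compactin Y1 {x \<in> topspace Y1. g x \<in> C}" by (simp add: preimage_on_def)
  next
    show "g \<in> topspace Y1 \<rightarrow> topspace Y2" using cont by (rule continuous_map_funspace)
  qed (simp_all add: cont Y2.lc Y2.Hausdorff locally_compact_imp_k_space Hausdorff_imp_kc_space)
qed

lemma inj_on_iff_CK:
  "inj_on g (topspace Y1) \<longleftrightarrow> (\<forall>K1\<in>CK Y1. \<forall>K2\<in>CK Y1. K1 \<inter> K2 = {} \<longrightarrow>
    (\<exists>L1\<in>CK Y2. \<exists>L2\<in>CK Y2. L1 \<inter> L2 = {} \<and> g ` K1 \<subseteq> L1 \<and> g ` K2 \<subseteq> L2))"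
proof (intro iffI ballI impI)
  fix K1 K2 assume inj: "inj_on g (topspace Y1)" and K: "K1 \<in> CK Y1" "K2 \<in> CK Y1" "K1 \<inter> K2 = {}"
  then have "g ` K1 \<inter> g ` K2 = {}"
    unfolding inj_on_def CK_def by (blast dest: compactin_subset_topspace)
  then obtain L1 where L1: "L1 \<in> CK Y2" "g ` K1 \<subseteq> L1" "L1 \<inter> g ` K2 = {}"
    by (rule Y2.compactin_separated_CK[OF image_CK[OF K(1)] Y2.compactin_closedin[OF image_CK[OF K(2)]]])
  have "closedin Y2 L1" "g ` K2 \<inter> L1 = {}" using L1 by (auto simp: CK_def CO_def)
  then obtain L2 where "L2 \<in> CK Y2" "g ` K2 \<subseteq> L2" "L2 \<inter> L1 = {}"
    by (rule Y2.compactin_separated_CK[OF image_CK[OF K(2)]])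
  with L1 show "\<exists>L1\<in>CK Y2. \<exists>L2\<in>CK Y2. L1 \<inter> L2 = {} \<and> g ` K1 \<subseteq> L1 \<and> g ` K2 \<subseteq> L2"
    by (intro bexI[of _ L1] bexI[of _ L2]) auto
next
  assume R: "\<forall>K1\<in>CK Y1. \<forall>K2\<in>CK Y1. K1 \<inter> K2 = {} \<longrightarrow>
    (\<exists>L1\<in>CK Y2. \<exists>L2\<in>CK Y2. L1 \<inter> L2 = {} \<and> g ` K1 \<subseteq> L1 \<and> g ` K2 \<subseteq> L2)"
  show "inj_on g (topspace Y1)"
  proof (rule inj_onI, rule ccontr)
    fix y z assume yz: "y \<in> topspace Y1" "z \<in> topspace Y1" "g y = g z" "y \<noteq> z"
    then obtain K1 where K1: "K1 \<in> CK Y1" "y \<in> K1" "z \<notin> K1"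
      using Y1.CK_separate_points by metis
    then have "compactin Y1 {z}" "closedin Y1 K1" "{z} \<inter> K1 = {}"
      using yz by (auto simp: CK_def CO_def)
    then obtain K2 where K2: "K2 \<in> CK Y1" "{z} \<subseteq> K2" "K2 \<inter> K1 = {}"
      by (rule Y1.compactin_separated_CK)
    then obtain L1 L2 where "L1 \<inter> L2 = {}" "g ` K1 \<subseteq> L1" "g ` K2 \<subseteq> L2"
      using R K1 by (metis Int_commute)
    with K1 K2 have "g y \<in> L1 \<inter> L2" using yz(3)
      by (metis IntI image_subset_iff insert_subset)
    with \<open>L1 \<inter> L2 = {}\<close> show False by simp
  qed
qed

lemma embedding_map_iff_CK:
  "embedding_map Y1 Y2 g \<longleftrightarrow> (\<forall>K\<in>CK Y1. \<exists>L\<in>CK Y2. K = preimage_on Y1 g L)"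
proof (intro iffI ballI)
  fix K assume emb: "embedding_map Y1 Y2 g" and K: "K \<in> CK Y1"
  obtain U where U: "openin Y2 U" "K = preimage_on Y1 g U"
    using embedding_map_openin[OF emb] K by (auto simp: CK_def CO_def)
  then have "g ` K \<subseteq> U" by (auto simp: preimage_on_def)
  then obtain L where "L \<in> CK Y2" "g ` K \<subseteq> L" "L \<subseteq> U"
    by (rule Y2.CK_between[OF image_CK[OF K] U(1)])
  with U show "\<exists>L\<in>CK Y2. K = preimage_on Y1 g L"
    unfolding preimage_on_def by blast
next
  assume R: "\<forall>K\<in>CK Y1. \<exists>L\<in>CK Y2. K = preimage_on Y1 g L"
  have inj: "inj_on g (topspace Y1)"
  proof (rule inj_onI, rule ccontr)
    fix y z assume yz: "y \<in> topspace Y1" "z \<in> topspace Y1" "g y = g z" "y \<noteq> z"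
    then obtain K where "K \<in> CK Y1" "y \<in> K" "z \<notin> K"
      using Y1.CK_separate_points by metis
    with R yz show False by (auto simp: preimage_on_def)
  qed
  let ?Z = "subtopology Y2 (g ` topspace Y1)"
  have "open_map Y1 ?Z g"
    unfolding open_map_def
  proof (intro allI impI)
    fix U assume U: "openin Y1 U"
    have "\<exists>T. openin ?Z T \<and> g x \<in> T \<and> T \<subseteq> g ` U" if x: "x \<in> U" for x
    proof -
      obtain K where K: "K \<in> CK Y1" "x \<in> K" "K \<subseteq> U" by (rule Y1.CK_base[OF U x])
      then obtain L where "L \<in> CK Y2" "K = preimage_on Y1 g L" using R by blast
      with K show ?thesis
        by (intro exI[of _ "L \<inter> g ` topspace Y1"])
          (auto simp: CK_def CO_def preimage_on_def openin_subtopology)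
    qed
    then show "openin ?Z (g ` U)" by (subst openin_subopen) blast
  qed
  with inj cont have "embedding_map Y1 ?Z g"
    by (intro injective_open_imp_embedding_map) (auto simp: continuous_map_in_subtopology)
  then show "embedding_map Y1 Y2 g"
    by (simp add: embedding_map_in_subtopology)
qed

end

section \<open>Existence of the extension\<close>

lemma extension_to_zd_lc_Hausdorff:
  assumes Y: "zd_lc_Hausdorff Y" and Z: "zd_lc_Hausdorff Z"
    and e: "e \<in> topspace X \<rightarrow> topspace Y"
    and dense: "Y closure_of (e ` topspace X) = topspace Y"
    and \<phi>: "\<phi> \<in> topspace X \<rightarrow> topspace Z"
    and CO: "\<And>M. M \<in> CO Z \<Longrightarrow> \<exists>N\<in>CO Y. preimage_on X \<phi> M = preimage_on X e N"
    and CK: "\<And>K. K \<in> CK Y \<Longrightarrow> \<exists>L\<in>CK Z. \<phi> ` preimage_on X e K \<subseteq> L"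
  shows "\<exists>g. continuous_map Y Z g \<and> (\<forall>x\<in>topspace X. g (e x) = \<phi> x)"
proof -
  interpret Y: zd_lc_Hausdorff Y by (rule Y)
  interpret Z: zd_lc_Hausdorff Z by (rule Z)
  obtain H where H: "\<And>M. M \<in> CO Z \<Longrightarrow> H M \<in> CO Y"
      and H_eq: "\<And>M. M \<in> CO Z \<Longrightarrow> preimage_on X \<phi> M = preimage_on X e (H M)"
    using CO by metis
  \<comment> \<open>Since traces determine clopen sets, every Boolean identity for \<open>H\<close>
    reduces to one for preimages under \<open>\<phi>\<close> and \<open>e\<close>.\<close>
  have H_unique: "H M = N" if "M \<in> CO Z" "N \<in> CO Y" "preimage_on X \<phi> M = preimage_on X e N" for M N
    using inj_onD[OF inj_on_preimage_on_dense[OF dense]] H H_eq that by metis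
  have H_mono: "N \<subseteq> H M" if "M \<in> CO Z" "N \<in> CO Y" "preimage_on X e N \<subseteq> preimage_on X \<phi> M" for M N
    using preimage_on_dense_subset[OF dense, of N "H M"] H[OF that(1)] H_eq[OF that(1)] that
    by (simp add: CO_def)
  have H_empty: "H {} = {}"
    by (rule H_unique) (simp_all add: CO_empty preimage_on_empty)
  have H_Un: "H (A \<union> B) = H A \<union> H B" if "A \<in> CO Z" "B \<in> CO Z" for A B
    by (rule H_unique) (simp_all add: that H CO_Un preimage_on_Un H_eq)
  have H_compl: "H (topspace Z - M) = topspace Y - H M" if "M \<in> CO Z" for M
  proof (rule H_unique)
    have "preimage_on X \<phi> (topspace Z) = topspace X" "preimage_on X e (topspace Y) = topspace X"
      using \<phi> e by (auto simp: preimage_on_def)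
    then show "preimage_on X \<phi> (topspace Z - M) = preimage_on X e (topspace Y - H M)"
      by (simp add: preimage_on_Diff H_eq[OF that])
  qed (simp_all add: that H CO_Diff CO_topspace)
  have "\<exists>z\<in>topspace Z. \<forall>M\<in>CO Z. z \<in> M \<longrightarrow> y \<in> H M" if y: "y \<in> topspace Y" for y
  proof -
    obtain K where K: "K \<in> CK Y" "y \<in> K" using Y.CK_base[OF openin_topspace y] by metis
    obtain L where L: "L \<in> CK Z" "\<phi> ` preimage_on X e K \<subseteq> L" using CK[OF K(1)] by blast
    have "K \<subseteq> H L"
      by (rule H_mono) (use K L in \<open>auto simp: CK_def preimage_on_def\<close>)
    let ?\<U> = "{M \<in> CO Z. y \<notin> H M}"
    \<comment> \<open>A point of \<open>L\<close> outside this union is the desired limit. A finite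
      subcover of \<open>L\<close> would have a union \<open>M\<close> with
      \<open>y \<notin> H M\<close>, although
      \<open>y \<in> K \<subseteq> H L \<subseteq> H M\<close>.\<close>
    have "\<not> L \<subseteq> \<Union>?\<U>"
    proof
      assume "L \<subseteq> \<Union>?\<U>"
      then obtain \<F> where \<F>: "finite \<F>" "\<F> \<subseteq> ?\<U>" "L \<subseteq> \<Union>\<F>"
        using compactinD[of Z L ?\<U>] L by (auto simp: CK_def CO_def)
      have "\<Union>\<F> \<in> ?\<U>"
        using \<F>(1,2) by (induction \<F>) (simp_all add: CO_empty H_empty CO_Un H_Un)
      moreover from this have "H L \<subseteq> H (\<Union>\<F>)"
        using L(1) \<F>(3) by (intro H_mono) (auto simp: CK_def H preimage_on_mono simp flip: H_eq)
      ultimately show False using K \<open>K \<subseteq> H L\<close> by blast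
    qed
    moreover have "L \<subseteq> topspace Z"
      using L by (simp add: CK_def compactin_subset_topspace)
    ultimately show ?thesis by blast
  qed
  then obtain g where g: "\<And>y. y \<in> topspace Y \<Longrightarrow> g y \<in> topspace Z"
      and gH: "\<And>y M. y \<in> topspace Y \<Longrightarrow> M \<in> CO Z \<Longrightarrow> g y \<in> M \<Longrightarrow> y \<in> H M"
    by metis
  have pre: "preimage_on Y g M = H M" if M: "M \<in> CO Z" for M
  proof
    show "preimage_on Y g M \<subseteq> H M" using gH M by (auto simp: preimage_on_def)
    \<comment> \<open>The choice of \<open>g\<close> gives only one inclusion; the other follows by
      applying it to the complement of \<open>M\<close>, with which \<open>H\<close>
      commutes.\<close>
    show "H M \<subseteq> preimage_on Y g M"
    proof
      fix y assume "y \<in> H M"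
      moreover have "H M \<subseteq> topspace Y" using H[OF M] openin_subset by (auto simp: CO_def)
      ultimately have "y \<in> topspace Y" "y \<notin> H (topspace Z - M)"
        by (auto simp: H_compl[OF M])
      then show "y \<in> preimage_on Y g M"
        using gH[of y "topspace Z - M"] g[of y] CO_Diff[OF CO_topspace M]
        by (auto simp: preimage_on_def)
    qed
  qed
  have "continuous_map Y Z g"
    by (rule continuous_map_CO_base[OF Z.zd]) (simp_all add: g pre H)
  \<comment> \<open>A compact clopen \<open>M\<close> separating the two points would give
    \<open>e x \<in> H M\<close>, and the trace of \<open>H M\<close> is the preimage of
    \<open>M\<close> under \<open>\<phi>\<close>, forcing \<open>\<phi> x \<in> M\<close>.\<close>
  moreover have "g (e x) = \<phi> x" if x: "x \<in> topspace X" for x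
  proof (rule ccontr)
    assume "g (e x) \<noteq> \<phi> x"
    moreover have "g (e x) \<in> topspace Z" "\<phi> x \<in> topspace Z" using g e \<phi> x by auto
    ultimately obtain M where M: "M \<in> CK Z" "g (e x) \<in> M" "\<phi> x \<notin> M"
      using Z.CK_separate_points by metis
    then have "M \<in> CO Z" by (simp add: CK_def)
    moreover have "e x \<in> topspace Y" using e x by auto
    ultimately have "x \<in> preimage_on X \<phi> M"
      using gH M(2) x by (simp add: H_eq) (simp add: preimage_on_def)
    with M(3) show False by (simp add: preimage_on_def)
  qed
  ultimately show ?thesis by blast
qed

section \<open>The commuting square: passing from \<open>g\<close> to \<open>f\<close> by
  traces\<close>

locale zd_lc_square = zd_lc_Hausdorff_map Y1 Y2 g
  for Y1 :: "'c topology" and Y2 :: "'d topology" and g +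
  fixes X1 :: "'a topology" and X2 :: "'b topology" and f1 f2 f
  assumes emb1: "embedding_map X1 Y1 f1" and dense1: "Y1 closure_of (f1 ` topspace X1) = topspace Y1"
    and emb2: "embedding_map X2 Y2 f2" and dense2: "Y2 closure_of (f2 ` topspace X2) = topspace Y2"
    and f: "f \<in> topspace X1 \<rightarrow> topspace X2"
    and commute: "\<And>x. x \<in> topspace X1 \<Longrightarrow> g (f1 x) = f2 (f x)"
begin

abbreviation "I1 \<equiv> preimage_on X1 f1 ` CK Y1"
abbreviation "I2 \<equiv> preimage_on X2 f2 ` CK Y2"

lemma cont1: "continuous_map X1 Y1 f1"
  and cont2: "continuous_map X2 Y2 f2"
  using emb1 emb2 by (simp_all add: embedding_map_imp_continuous_map)

text \<open>Both sides are the preimage of \<open>M\<close> under the diagonal of the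
  square.\<close>

lemma preimage_on_commute:
  "preimage_on X1 f (preimage_on X2 f2 M) = preimage_on X1 f1 (preimage_on Y1 g M)"
  using f continuous_map_funspace[OF cont1] by (auto simp: preimage_on_def commute Pi_iff)

lemma closure_of_g_image:
  assumes U: "openin Y1 U"
  shows "Y2 closure_of (g ` U) = Y2 closure_of (f2 ` f ` preimage_on X1 f1 U)"
proof -
  let ?S = "f1 ` preimage_on X1 f1 U"
  have eq: "f2 ` f ` preimage_on X1 f1 U = g ` ?S"
    using commute by (force simp: preimage_on_def image_image)
  have "g ` U \<subseteq> g ` (Y1 closure_of ?S)"
    unfolding closure_of_preimage_dense[OF cont1 dense1 U]
    by (intro image_mono closure_of_subset openin_subset U)
  also have "\<dots> \<subseteq> Y2 closure_of (g ` ?S)"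
    by (rule continuous_map_image_closure_subset[OF cont])
  finally have "Y2 closure_of (g ` U) \<subseteq> Y2 closure_of (g ` ?S)"
    by (simp add: closure_of_minimal)
  moreover have "Y2 closure_of (g ` ?S) \<subseteq> Y2 closure_of (g ` U)"
    by (intro closure_of_mono image_mono) (auto simp: preimage_on_def)
  ultimately show ?thesis by (simp add: eq)
qed

lemma closure_of_f_image:
  assumes U: "openin Y1 U"
  shows "X2 closure_of (f ` preimage_on X1 f1 U) = preimage_on X2 f2 (Y2 closure_of (g ` U))"
  unfolding closure_of_g_image[OF U]
  by (rule embedding_map_closure_of[OF emb2]) (use f in \<open>auto simp: preimage_on_def\<close>)

lemma f_image_subset_iff:
  assumes U: "openin Y1 U" and C: "closedin Y2 C"
  shows "f ` preimage_on X1 f1 U \<subseteq> preimage_on X2 f2 C \<longleftrightarrow> g ` U \<subseteq> C"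
proof
  assume "f ` preimage_on X1 f1 U \<subseteq> preimage_on X2 f2 C"
  then have "f2 ` f ` preimage_on X1 f1 U \<subseteq> C" by (auto simp: preimage_on_def)
  then have "Y2 closure_of (g ` U) \<subseteq> C"
    unfolding closure_of_g_image[OF U] using C by (rule closure_of_minimal)
  moreover have "g ` U \<subseteq> topspace Y2"
    using openin_subset[OF U] continuous_map_image_subset_topspace[OF cont] by blast
  ultimately show "g ` U \<subseteq> C" using closure_of_subset by blast
next
  assume "g ` U \<subseteq> C"
  then show "f ` preimage_on X1 f1 U \<subseteq> preimage_on X2 f2 C"
    using f commute by (force simp: preimage_on_def)
qed

lemma disjoint_iff1:
  assumes "K \<in> CK Y1" "L \<in> CK Y1"
  shows "preimage_on X1 f1 K \<inter> preimage_on X1 f1 L = {} \<longleftrightarrow> K \<inter> L = {}"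
  using preimage_on_dense_eq_empty_iff[OF dense1, of "K \<inter> L"] assms
  by (simp add: preimage_on_Int CK_def CO_def openin_Int)

lemma disjoint_iff2:
  assumes "K \<in> CK Y2" "L \<in> CK Y2"
  shows "preimage_on X2 f2 K \<inter> preimage_on X2 f2 L = {} \<longleftrightarrow> K \<inter> L = {}"
  using preimage_on_dense_eq_empty_iff[OF dense2, of "K \<inter> L"] assms
  by (simp add: preimage_on_Int CK_def CO_def openin_Int)

text \<open>Uses the criterion by images of nonempty open sets: open sets upstairs and downstairs
  correspond by traces, and nonemptiness is preserved both ways by density.\<close>

lemma skeletal_iff: "skeletal_map Y1 Y2 g \<longleftrightarrow> skeletal_map X1 X2 f"
proof -
  have "(\<forall>U. openin Y1 U \<and> U \<noteq> {} \<longrightarrow> Y2 interior_of (Y2 closure_of (g ` U)) \<noteq> {}) \<longleftrightarrow>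
    (\<forall>U. openin X1 U \<and> U \<noteq> {} \<longrightarrow> X2 interior_of (X2 closure_of (f ` U)) \<noteq> {})"
    (is "?L \<longleftrightarrow> ?R")
  proof (intro iffI allI impI; elim conjE)
    fix U assume L: ?L and U: "openin X1 U" "U \<noteq> {}"
    obtain U' where U': "openin Y1 U'" "U = preimage_on X1 f1 U'"
      using U(1) by (rule embedding_map_openin[OF emb1])
    let ?W = "Y2 interior_of (Y2 closure_of (g ` U'))"
    have "?W \<noteq> {}" using L U U' by (auto simp: preimage_on_def)
    then have "preimage_on X2 f2 ?W \<noteq> {}"
      by (simp add: preimage_on_dense_eq_empty_iff[OF dense2])
    moreover have "preimage_on X2 f2 ?W \<subseteq> X2 closure_of (f ` U)"
      by (simp add: U' closure_of_f_image preimage_on_mono interior_of_subset)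
    ultimately show "X2 interior_of (X2 closure_of (f ` U)) \<noteq> {}"
      using interior_of_maximal openin_preimage_on[OF cont2 openin_interior_of] by (metis subset_empty)
  next
    fix U assume R: ?R and U: "openin Y1 U" "U \<noteq> {}"
    let ?W = "X2 interior_of (X2 closure_of (f ` preimage_on X1 f1 U))"
    have "preimage_on X1 f1 U \<noteq> {}"
      using U by (simp add: preimage_on_dense_eq_empty_iff[OF dense1])
    then have W: "?W \<noteq> {}" using R openin_preimage_on[OF cont1 U(1)] by blast
    obtain W' where W': "openin Y2 W'" "?W = preimage_on X2 f2 W'"
      using openin_interior_of by (rule embedding_map_openin[OF emb2])
    \<comment> \<open>\<open>W'\<close> is open and the closure is closed, so this inclusion of
      traces lifts to \<open>Y2\<close>.\<close>
    have "preimage_on X2 f2 W' \<subseteq> preimage_on X2 f2 (Y2 closure_of (g ` U))"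
      using interior_of_subset by (simp flip: W'(2) closure_of_f_image[OF U(1)])
    then have "W' \<subseteq> Y2 closure_of (g ` U)"
      using W'(1) by (intro preimage_on_dense_subset[OF dense2]) auto
    moreover have "W' \<noteq> {}" using W W' by (auto simp: preimage_on_empty)
    ultimately show "Y2 interior_of (Y2 closure_of (g ` U)) \<noteq> {}"
      using W'(1) interior_of_maximal by (metis subset_empty)
  qed
  then show ?thesis
    by (simp add: skeletal_map_iff continuous_map_funspace[OF cont] f)
qed

text \<open>\<open>g\<close> K\<open>is compact, hence closed, so the closure of the image of the
  trace of\<close>K\<open>is exactly the trace of\<close>g \<open>K\<close>.\<close>

lemma open_iff: "cont_open_map Y1 Y2 g \<longleftrightarrow> (\<forall>F\<in>I1. X2 closure_of (f ` F) \<in> I2)"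
proof -
  have "g ` K \<in> CK Y2 \<longleftrightarrow> X2 closure_of (f ` preimage_on X1 f1 K) \<in> I2" if K: "K \<in> CK Y1" for K
  proof -
    have closed: "closedin Y2 (g ` K)" by (rule Y2.compactin_closedin[OF image_CK[OF K]])
    have op: "openin Y1 K" using K by (simp add: CK_def CO_def)
    have eq: "X2 closure_of (f ` preimage_on X1 f1 K) = preimage_on X2 f2 (g ` K)"
      by (simp add: closure_of_f_image[OF op] closure_of_closedin[OF closed])
    have "g ` K = L" if L: "L \<in> CK Y2" "preimage_on X2 f2 (g ` K) = preimage_on X2 f2 L" for L
    proof
      have "f ` preimage_on X1 f1 K \<subseteq> preimage_on X2 f2 L"
        using f_image_subset_iff[OF op closed] L(2) by simp
      then show "g ` K \<subseteq> L"
        using f_image_subset_iff[OF op, of L] L(1) by (simp add: CK_def CO_def)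
      show "L \<subseteq> g ` K"
        by (rule preimage_on_dense_subset[OF dense2 _ closed]) (use L in \<open>simp_all add: CK_def CO_def\<close>)
    qed
    then show ?thesis unfolding eq by blast
  qed
  then show ?thesis
    by (simp add: cont_open_map_def cont open_map_iff_CK)
qed

text \<open>The preimage of \<open>L\<close> under \<open>g\<close> is clopen in any case, so its
  trace lies in \<open>I1\<close> exactly when it is itself compact.\<close>

lemma perfect_iff: "perfect_into_map Y1 Y2 g \<longleftrightarrow> (\<forall>G\<in>I2. preimage_on X1 f G \<in> I1)"
proof -
  have "preimage_on Y1 g L \<in> CK Y1 \<longleftrightarrow> preimage_on X1 f (preimage_on X2 f2 L) \<in> I1"
    if "L \<in> CK Y2" for L
    unfolding preimage_on_commute
    using inj_on_image_mem_iff[OF inj_on_preimage_on_dense[OF dense1], of "preimage_on Y1 g L" "CK Y1"]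
      CO_preimage_on[OF cont, of L] that by (auto simp: CK_def)
  then show ?thesis
    by (simp add: perfect_into_map_iff_proper_map proper_map_iff_CK)
qed

lemma dense_iff:
  "Y2 closure_of (g ` topspace Y1) = topspace Y2 \<longleftrightarrow> X2 closure_of (f ` topspace X1) = topspace X2"
proof -
  have pre1: "preimage_on X1 f1 (topspace Y1) = topspace X1"
    and pre2: "preimage_on X2 f2 (topspace Y2) = topspace X2"
    using continuous_map_funspace[OF cont1] continuous_map_funspace[OF cont2]
    by (auto simp: preimage_on_def)
  have eq: "X2 closure_of (f ` topspace X1) = preimage_on X2 f2 (Y2 closure_of (g ` topspace Y1))"
    using closure_of_f_image[OF openin_topspace] by (simp add: pre1)
  show ?thesis
  proof
    assume "X2 closure_of (f ` topspace X1) = topspace X2"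
    then have "topspace Y2 \<subseteq> Y2 closure_of (g ` topspace Y1)"
      by (intro preimage_on_dense_subset[OF dense2]) (simp_all add: eq pre2)
    then show "Y2 closure_of (g ` topspace Y1) = topspace Y2"
      by (simp add: closure_of_subset_topspace subset_antisym)
  qed (simp add: eq pre2)
qed

lemma inj_iff:
  "inj_on g (topspace Y1) \<longleftrightarrow> (\<forall>F1\<in>I1. \<forall>F2\<in>I1. F1 \<inter> F2 = {} \<longrightarrow>
    (\<exists>G1\<in>I2. \<exists>G2\<in>I2. G1 \<inter> G2 = {} \<and> f ` F1 \<subseteq> G1 \<and> f ` F2 \<subseteq> G2))"
proof -
  have "f ` preimage_on X1 f1 K \<subseteq> preimage_on X2 f2 L \<longleftrightarrow> g ` K \<subseteq> L"
    if "K \<in> CK Y1" "L \<in> CK Y2" for K L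
    using that by (intro f_image_subset_iff) (auto simp: CK_def CO_def)
  then show ?thesis
    unfolding inj_on_iff_CK by (simp add: disjoint_iff1 disjoint_iff2 cong: ball_cong bex_cong)
qed

text \<open>Injectivity of traces on \<open>CO Y1\<close> turns an equation between sets in
  \<open>Y1\<close> into one between their traces.\<close>

lemma embedding_iff: "embedding_map Y1 Y2 g \<longleftrightarrow> I1 \<subseteq> preimage_on X1 f ` I2"
proof -
  have "K = preimage_on Y1 g L \<longleftrightarrow> preimage_on X1 f1 K = preimage_on X1 f (preimage_on X2 f2 L)"
    if "K \<in> CK Y1" "L \<in> CK Y2" for K L
    unfolding preimage_on_commute
    using inj_on_eq_iff[OF inj_on_preimage_on_dense[OF dense1], of K "preimage_on Y1 g L"]
      CO_preimage_on[OF cont, of L] that by (simp add: CK_def)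
  then show ?thesis
    unfolding embedding_map_iff_CK by (simp add: image_subset_iff image_iff)
qed

lemma embedding_imp_inj: "embedding_map Y1 Y2 g \<Longrightarrow> inj_on g (topspace Y1)"
  by (simp add: embedding_map_def homeomorphic_map_def)

text \<open>An injective continuous open map is an embedding, so this combines the criteria for
  embeddings and open maps.\<close>

lemma open_inj_iff:
  "cont_open_map Y1 Y2 g \<and> inj_on g (topspace Y1) \<longleftrightarrow>
    I1 \<subseteq> preimage_on X1 f ` I2 \<and> (\<forall>F\<in>I1. X2 closure_of (f ` F) \<in> I2)"
  unfolding embedding_iff[symmetric] open_iff[symmetric]
  using embedding_imp_inj injective_open_imp_embedding_map by (auto simp: cont_open_map_def)

text \<open>An injective continuous closed map is the same as a proper embedding; properness and
  embedding account for the two inclusions of the set equality.\<close>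

lemma closed_inj_iff:
  "cont_closed_map Y1 Y2 g \<and> inj_on g (topspace Y1) \<longleftrightarrow> preimage_on X1 f ` I2 = I1"
proof -
  have "cont_closed_map Y1 Y2 g \<and> inj_on g (topspace Y1) \<longleftrightarrow>
      perfect_into_map Y1 Y2 g \<and> embedding_map Y1 Y2 g"
    using embedding_imp_inj injective_closed_imp_embedding_map[of Y1 Y2 g]
      injective_imp_proper_eq_closed_map[of g Y1 Y2]
    unfolding perfect_into_map_iff_proper_map cont_closed_map_def using cont by blast
  then show ?thesis
    unfolding perfect_iff embedding_iff by blast
qed

text \<open>A perfect map has closed image, so it is onto iff its image is dense.\<close>

lemma perfect_surj_iff:
  "perfect_into_map Y1 Y2 g \<and> g ` topspace Y1 = topspace Y2 \<longleftrightarrow>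
    (\<forall>G\<in>I2. preimage_on X1 f G \<in> I1) \<and> X2 closure_of (f ` topspace X1) = topspace X2"
proof -
  have "g ` topspace Y1 = topspace Y2 \<longleftrightarrow> Y2 closure_of (g ` topspace Y1) = topspace Y2"
    if "perfect_into_map Y1 Y2 g"
  proof -
    have "closedin Y2 (g ` topspace Y1)"
      using that by (simp add: perfect_into_map_def cont_closed_map_def closed_map_def)
    then show ?thesis by (simp add: closure_of_closedin)
  qed
  then show ?thesis
    unfolding perfect_iff[symmetric] dense_iff[symmetric] by blast
qed

lemma dense_embedding_iff:
  "dense_embedding Y1 Y2 g \<longleftrightarrow>
    X2 closure_of (f ` topspace X1) = topspace X2 \<and> I1 \<subseteq> preimage_on X1 f ` I2"
  unfolding dense_embedding_def dense_iff embedding_iff by blast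

end

section \<open>Existence of \<open>g\<close> and the nine equivalences\<close>

theorem theorem4p8:
  fixes X1 :: "'a topology" and X2 :: "'b topology"
    and Y1 :: "'c topology" and Y2 :: "'d topology"
    and f1 :: "'a \<Rightarrow> 'c" and f2 :: "'b \<Rightarrow> 'd" and f :: "'a \<Rightarrow> 'b"
    and A1 I1 :: "'a set set" and A2 I2 :: "'b set set"
  assumes X1: "zero_dimensional X1" "Hausdorff_space X1"
    and X2: "zero_dimensional X2" "Hausdorff_space X2"
    and Y1: "zd_local_compactification X1 Y1 f1"
    and Y2: "zd_local_compactification X2 Y2 f2"
    and A1: "A1 = preimage_on X1 f1 ` CO Y1" and I1: "I1 = preimage_on X1 f1 ` CK Y1"
    and A2: "A2 = preimage_on X2 f2 ` CO Y2" and I2: "I2 = preimage_on X2 f2 ` CK Y2"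
    and f: "f \<in> topspace X1 \<rightarrow> topspace X2"
    and f_A: "\<forall>G\<in>A2. preimage_on X1 f G \<in> A1"
    and f_I: "\<forall>F\<in>I1. \<exists>G\<in>I2. f ` F \<subseteq> G"
  shows "(\<exists>g. continuous_map Y1 Y2 g \<and> (\<forall>x\<in>topspace X1. g (f1 x) = f2 (f x))) \<and>
    (\<forall>g. continuous_map Y1 Y2 g \<and> (\<forall>x\<in>topspace X1. g (f1 x) = f2 (f x)) \<longrightarrow>
      \<comment> \<open>(a)\<close>
      (skeletal_map Y1 Y2 g \<longleftrightarrow> skeletal_map X1 X2 f) \<and>
      \<comment> \<open>(b)\<close>
      (cont_open_map Y1 Y2 g \<longleftrightarrow> (\<forall>F\<in>I1. X2 closure_of (f ` F) \<in> I2)) \<and>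
      \<comment> \<open>(c)\<close>
      (perfect_into_map Y1 Y2 g \<longleftrightarrow> (\<forall>G\<in>I2. preimage_on X1 f G \<in> I1)) \<and>
      \<comment> \<open>(d)\<close>
      (Y2 closure_of (g ` topspace Y1) = topspace Y2 \<longleftrightarrow>
         X2 closure_of (f ` topspace X1) = topspace X2) \<and>
      \<comment> \<open>(e)\<close>
      (inj_on g (topspace Y1) \<longleftrightarrow>
         (\<forall>F1\<in>I1. \<forall>F2\<in>I1. F1 \<inter> F2 = {} \<longrightarrow>
            (\<exists>G1\<in>I2. \<exists>G2\<in>I2. G1 \<inter> G2 = {} \<and> f ` F1 \<subseteq> G1 \<and> f ` F2 \<subseteq> G2))) \<and>
      \<comment> \<open>(f)\<close>
      (cont_open_map Y1 Y2 g \<and> inj_on g (topspace Y1) \<longleftrightarrow>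
         I1 \<subseteq> preimage_on X1 f ` I2 \<and> (\<forall>F\<in>I1. X2 closure_of (f ` F) \<in> I2)) \<and>
      \<comment> \<open>(g)\<close>
      (cont_closed_map Y1 Y2 g \<and> inj_on g (topspace Y1) \<longleftrightarrow> preimage_on X1 f ` I2 = I1) \<and>
      \<comment> \<open>(h)\<close>
      (perfect_into_map Y1 Y2 g \<and> g ` topspace Y1 = topspace Y2 \<longleftrightarrow>
         (\<forall>G\<in>I2. preimage_on X1 f G \<in> I1) \<and>
         X2 closure_of (f ` topspace X1) = topspace X2) \<and>
      \<comment> \<open>(i)\<close>
      (dense_embedding Y1 Y2 g \<longleftrightarrow>
         X2 closure_of (f ` topspace X1) = topspace X2 \<and> I1 \<subseteq> preimage_on X1 f ` I2))"
proof -
  have Y: "zd_lc_Hausdorff Y1" "zd_lc_Hausdorff Y2"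
    and d1: "embedding_map X1 Y1 f1" "Y1 closure_of (f1 ` topspace X1) = topspace Y1"
    and d2: "embedding_map X2 Y2 f2" "Y2 closure_of (f2 ` topspace X2) = topspace Y2"
    using Y1 Y2 by (simp_all add: zd_local_compactification_def dense_embedding_def zd_lc_Hausdorff_def)
  have f1: "f1 \<in> topspace X1 \<rightarrow> topspace Y1" and f2: "f2 \<in> topspace X2 \<rightarrow> topspace Y2"
    using d1(1) d2(1) by (simp_all add: embedding_map_imp_continuous_map continuous_map_funspace)
  \<comment> \<open>The map to be extended along \<open>f1\<close> is the diagonal
    \<open>f2 \<circ> f\<close>; \<open>f_A\<close> yields the condition on clopen sets and
    \<open>f_I\<close> the one on compact clopen sets.\<close>
  have "\<exists>g. continuous_map Y1 Y2 g \<and> (\<forall>x\<in>topspace X1. g (f1 x) = (f2 \<circ> f) x)"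
  proof (rule extension_to_zd_lc_Hausdorff[OF Y f1 d1(2)])
    show "f2 \<circ> f \<in> topspace X1 \<rightarrow> topspace Y2" using f f2 by auto
    show "\<exists>N\<in>CO Y1. preimage_on X1 (f2 \<circ> f) M = preimage_on X1 f1 N" if "M \<in> CO Y2" for M
    proof -
      have "preimage_on X1 (f2 \<circ> f) M = preimage_on X1 f (preimage_on X2 f2 M)"
        using f by (auto simp: preimage_on_def)
      with f_A that show ?thesis by (simp add: A1 A2 image_iff)
    qed
    show "\<exists>L\<in>CK Y2. (f2 \<circ> f) ` preimage_on X1 f1 K \<subseteq> L" if K: "K \<in> CK Y1" for K
    proof -
      obtain L where "L \<in> CK Y2" "f ` preimage_on X1 f1 K \<subseteq> preimage_on X2 f2 L"
        using f_I K unfolding I1 I2 by (metis (no_types, lifting) image_iff)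
      then show ?thesis by (intro bexI[of _ L]) (auto simp: preimage_on_def)
    qed
  qed
  then have "\<exists>g. continuous_map Y1 Y2 g \<and> (\<forall>x\<in>topspace X1. g (f1 x) = f2 (f x))"
    by simp
  then show ?thesis
    unfolding I1 I2
  proof (rule conjI, intro allI impI, goal_cases)
    case (1 g)
    with Y d1 d2 f interpret sq: zd_lc_square Y1 Y2 g X1 X2 f1 f2 f
      by (simp add: zd_lc_square_def zd_lc_square_axioms_def zd_lc_Hausdorff_map_def
          zd_lc_Hausdorff_map_axioms_def)
    show ?case
      by (intro conjI sq.skeletal_iff sq.open_iff sq.perfect_iff sq.dense_iff sq.inj_iff
          sq.open_inj_iff sq.closed_inj_iff sq.perfect_surj_iff sq.dense_embedding_iff)
  qed
qed

end
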